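(* Let $M=(m_i)_{i=0}^{\infty}$ be a sequence of integers with $m_0=1$ and $m_i\ge 2$ for $i\ge 1$, and put $M_i=\prod_{j=0}^{i}m_j$. For an integer $a\ge 0$ let $f(a,t)=\frac{t^{a}-1}{t-1}\in\mathbb{Z}[t]$. For a positive integer $h$ define \[ g_h(t):=\gcd\big(t^{m_1+m_2-1}f(m_2,t^{m_1-1}),\ t^{m_2+m_3-1}f(m_3,t^{m_2-1}),\ \ldots,\ t^{m_h+m_{h+1}-1}f(m_{h+1},t^{m_h-1})\big). \] Let $n\in\mathbb{N}$ and let $n=a_0+a_1M_1+\cdots+a_kM_k$ be its $M$-ary representation, i.e. $a_j\in\{0,1,\ldots,m_{j+1}-1\}$ for every $j$. Then \[ p_M(n,t)\equiv t^{a_0}\prod_{j=1}^{k}t^{a_j}f(a_j+1,t^{m_j-1}) \pmod{g_k(t)}. \]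
   Context: The $M$-ary partition polynomials $p_M(n,t)\in\mathbb{Z}[t]$ are defined by the power series expansion $\prod_{j=0}^{\infty}\frac{1}{1-tq^{M_j}}=\sum_{n=0}^{\infty}p_M(n,t)q^n$. For monic polynomials $f_1,f_2\in\mathbb{Z}[x]$, $\gcd(f_1,f_2)$ denotes a (monic) polynomial of highest possible degree dividing both, and $\gcd(f_1,\ldots,f_k):=\gcd(\gcd(f_1,\ldots,f_{k-1}),f_k)$. Congruence modulo a polynomial $g$ means the difference is divisible by $g$ in $\mathbb{Z}[t]$. *)

theory Defs
  imports
    "HOL-Analysis.Infinite_Products"
    "HOL-Computational_Algebra.Polynomial_Factorial"
    "HOL-Computational_Algebra.Formal_Power_Series"
begin

definition Mprod :: "(nat \<Rightarrow> nat) \<Rightarrow> nat \<Rightarrow> nat" where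
  "Mprod m i = (\<Prod>j\<le>i. m j)"

text \<open>
  Generating functions are formal power series in \<open>q\<close> (\<^const>\<open>fps_X\<close>) over the ring
  \<open>\<int>[t]\<close>, where \<open>t\<close> is \<open>monom 1 1\<close>.  Since \<open>\<int>[t]\<close> has no \<^const>\<open>inverse\<close>, the factor
  \<open>1 / (1 - t q^w)\<close> is the ring inverse \<open>fps_right_inverse\<close>, whose last argument is the
  inverse of the constant coefficient \<open>1\<close>.
\<close>

definition part_factor :: "nat \<Rightarrow> int poly fps" where
  "part_factor w = fps_right_inverse (1 - fps_const (monom 1 1) * fps_X ^ w) 1"

text \<open>The infinite product is taken in the \<open>q\<close>-adic topology of \<^typ>\<open>int poly fps\<close>.\<close>

definition partition_poly :: "(nat \<Rightarrow> nat) \<Rightarrow> nat \<Rightarrow> int poly" where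
  "partition_poly m n = fps_nth (prodinf (\<lambda>j. part_factor (Mprod m j))) n"

text \<open>\<open>div\<close> on \<^typ>\<open>int poly\<close> is exact division here.\<close>

definition f_poly :: "nat \<Rightarrow> int poly" where
  "f_poly a = (monom 1 a - 1) div (monom 1 1 - 1)"

text \<open>
  The arguments are monic, so \<^const>\<open>Gcd\<close> on \<^typ>\<open>int poly\<close> yields the monic common divisor of
  highest degree (\<open>gcd_monic_int_poly\<close>).  For \<open>h = 0\<close> the gcd of no polynomials is \<open>0\<close>, so that
  congruence modulo \<open>g_poly m 0\<close> is equality.
\<close>

definition g_poly :: "(nat \<Rightarrow> nat) \<Rightarrow> nat \<Rightarrow> int poly" where
  "g_poly m h = Gcd ((\<lambda>i. monom 1 (m i + m (i + 1) - 1) *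
                        pcompose (f_poly (m (i + 1))) (monom 1 (m i - 1))) ` {1..h})"

lemma part_factor_inverse:
  assumes "w > 0"
  shows "(1 - fps_const (monom 1 1) * fps_X ^ w) * part_factor w = 1"
  unfolding part_factor_def using assms by (intro fps_right_inverse) simp

lemma part_factor_nth_less:
  assumes "0 < n" "n < w"
  shows "fps_nth (part_factor w) n = 0"
proof -
  have "part_factor w = 1 + fps_const (monom 1 1) * (fps_X ^ w * part_factor w)"
    using part_factor_inverse[of w] assms by (simp add: algebra_simps)
  then have "fps_nth (part_factor w) n =
      fps_nth (1 + fps_const (monom 1 1) * (fps_X ^ w * part_factor w)) n"
    by simp
  then show ?thesis
    using assms by (simp add: fps_X_power_mult_nth)
qed

lemma part_factor_nth_0 [simp]: "fps_nth (part_factor w) 0 = 1"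
  by (simp add: part_factor_def)

lemma Mprod_gt:
  assumes "m 0 = 1" "\<And>i. i \<ge> 1 \<Longrightarrow> m i \<ge> 2"
  shows "i < Mprod m i"
proof (induction i)
  case 0
  then show ?case using assms by (simp add: Mprod_def)
next
  case (Suc i)
  have "2 * Mprod m i \<le> Mprod m (Suc i)"
    using assms(2)[of "Suc i"] by (simp add: Mprod_def)
  then show ?case using Suc by linarith
qed

lemma partial_prod_nth_stable:
  assumes "m 0 = 1" "\<And>i. i \<ge> 1 \<Longrightarrow> m i \<ge> 2" "n \<le> N"
  shows "fps_nth (\<Prod>j\<le>N. part_factor (Mprod m j)) n =
         fps_nth (\<Prod>j\<le>n. part_factor (Mprod m j)) n"
  using assms(3)
proof (induction N rule: dec_induct)
  case base
  then show ?case by simp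
next
  case (step N)
  let ?P = "\<Prod>j\<le>N. part_factor (Mprod m j)"
  have "Suc N < Mprod m (Suc N)"
    by (rule Mprod_gt) (use assms in auto)
  then have z: "fps_nth (part_factor (Mprod m (Suc N))) i = 0" if "0 < i" "i \<le> n" for i
    using that step by (intro part_factor_nth_less) auto
  have "fps_nth (?P * part_factor (Mprod m (Suc N))) n =
      (\<Sum>i=0..n. fps_nth ?P i * fps_nth (part_factor (Mprod m (Suc N))) (n - i))"
    by (simp add: fps_mult_nth)
  also have "\<dots> = (\<Sum>i=0..n. if i = n then fps_nth ?P n else 0)"
    by (intro sum.cong) (auto simp: z)
  finally show ?case using step by simp
qed

lemma partition_prod_has_prod:
  assumes "m 0 = 1" "\<And>i. i \<ge> 1 \<Longrightarrow> m i \<ge> 2"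
  shows "(\<lambda>j. part_factor (Mprod m j)) has_prod
           Abs_fps (\<lambda>n. fps_nth (\<Prod>j\<le>n. part_factor (Mprod m j)) n)"
    (is "_ has_prod ?p")
proof -
  have "(\<lambda>N. \<Prod>j\<le>N. part_factor (Mprod m j)) \<longlonglongrightarrow> ?p"
  proof (rule tendsto_fpsI)
    fix n
    show "\<forall>\<^sub>F N in sequentially. fps_nth (\<Prod>j\<le>N. part_factor (Mprod m j)) n = fps_nth ?p n"
      using eventually_ge_at_top[of n]
    proof eventually_elim
      case (elim N)
      show ?case
        unfolding fps_nth_Abs_fps using assms elim by (rule partial_prod_nth_stable)
    qed
  qed
  moreover have "?p \<noteq> 0"
  proof
    assume "?p = 0"
    then have "fps_nth ?p 0 = 0" by simp
    then show False by simp
  qed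
  ultimately show ?thesis
    by (simp add: has_prod_def raw_has_prod_def)
qed

lemma partition_poly_eq:
  assumes "m 0 = 1" "\<And>i. i \<ge> 1 \<Longrightarrow> m i \<ge> 2"
  shows "partition_poly m n = fps_nth (\<Prod>j\<le>n. part_factor (Mprod m j)) n"
  unfolding partition_poly_def
  by (subst has_prod_unique[OF partition_prod_has_prod[of m, OF assms], symmetric]) simp_all

lemma f_poly_mult: "f_poly a * (monom 1 1 - 1) = monom 1 a - 1"
proof -
  have "(monom 1 1 :: int poly) - 1 dvd monom 1 1 ^ a - 1"
    by (metis dvd_triv_left power_diff_1_eq)
  then show ?thesis by (simp add: f_poly_def monom_power)
qed

lemma f_poly_eq_sum: "f_poly a = (\<Sum>i<a. monom 1 i)"
proof -
  have "monom 1 1 ^ a - 1 = (monom 1 1 - 1 :: int poly) * (\<Sum>i<a. monom 1 1 ^ i)"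
    by (rule power_diff_1_eq)
  then have "f_poly a * (monom 1 1 - 1) = (\<Sum>i<a. monom 1 i) * (monom 1 1 - 1)"
    by (simp only: f_poly_mult monom_power mult.commute mult_1_left mult_1_right power_one)
  moreover have "(monom 1 1 :: int poly) - 1 \<noteq> 0"
    by (metis degree_1 degree_monom_eq eq_iff_diff_eq_0 one_neq_zero)
  ultimately show ?thesis by simp
qed

lemma g_poly_0 [simp]: "g_poly m 0 = 0"
  by (simp add: g_poly_def)

lemma g_poly_Suc:
  "g_poly m (Suc h) = gcd (g_poly m h)
     (monom 1 (m (h + 1) + m (h + 2) - 1) * pcompose (f_poly (m (h + 2))) (monom 1 (m (h + 1) - 1)))"
  by (simp add: g_poly_def atLeastAtMostSuc_conv gcd.commute)

lemma gcd_monic_int_poly: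
  fixes p q :: "int poly"
  assumes "lead_coeff p = 1" "lead_coeff q = 1"
  shows "lead_coeff (gcd p q) = 1"
    and "d dvd p \<Longrightarrow> d dvd q \<Longrightarrow> degree d \<le> degree (gcd p q)"
proof -
  have nz: "gcd p q \<noteq> 0" using assms by auto
  obtain r where "p = gcd p q * r" by (meson dvdE gcd_dvd1)
  then have "lead_coeff (gcd p q) * lead_coeff r = 1"
    using assms(1) by (metis lead_coeff_mult)
  then have u: "is_unit (lead_coeff (gcd p q))" by (metis dvd_triv_left)
  have "normalize (gcd p q) = gcd p q" by simp
  then have "unit_factor (gcd p q) = 1"
    using unit_factor_normalize[OF nz] by (simp only:)
  then have "unit_factor (lead_coeff (gcd p q)) = 1"
    by (simp add: unit_factor_poly_def monom_0 one_pCons)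
  then show "lead_coeff (gcd p q) = 1"
    using u by (metis is_unit_unit_factor)
  show "d dvd p \<Longrightarrow> d dvd q \<Longrightarrow> degree d \<le> degree (gcd p q)"
    using nz by (meson dvd_imp_degree_le gcd_greatest)
qed

end

theory Submission
  imports Defs
begin

text \<open>
  Let \<open>P\<^sub>k\<close> be the product of the factors \<open>1 / (1 - t q^M\<^sub>j)\<close> over \<open>j \<le> k\<close>, so that
  \<open>P\<^sub>k\<^sub>+\<^sub>1 (1 - t q^M\<^sub>k\<^sub>+\<^sub>1) = P\<^sub>k\<close>.  By induction on \<open>k\<close>, for digits \<open>a\<^sub>0, \<dots>, a\<^sub>k\<close> and an
  unrestricted top digit \<open>b\<close>, the coefficient of \<open>P\<^sub>k\<^sub>+\<^sub>1\<close> at \<open>a\<^sub>0 + \<dots> + a\<^sub>k M\<^sub>k + b M\<^sub>k\<^sub>+\<^sub>1\<close> is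
  congruent modulo \<open>g\<^sub>k\<close> to the claimed product with last factor \<open>t^b f(b + 1, t^(m\<^sub>k\<^sub>+\<^sub>1 - 1))\<close>.
  For the step, the top digit \<open>a + d m\<^sub>k\<^sub>+\<^sub>1\<close> at level \<open>k\<close> may be split: modulo
  \<open>t^(m\<^sub>k + m\<^sub>k\<^sub>+\<^sub>1 - 1) f(m\<^sub>k\<^sub>+\<^sub>1, t^(m\<^sub>k - 1))\<close> its factor reduces to \<open>t^(d m\<^sub>k\<^sub>+\<^sub>1)\<close> times the
  factor of \<open>a\<close>, and summing these powers over the multiplicity of the part \<open>M\<^sub>k\<^sub>+\<^sub>1\<close> produces
  the next factor.
\<close>

lemma pcompose_f_poly: "pcompose (f_poly a) p = (\<Sum>i<a. p ^ i)"
proof -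
  have "pcompose (monom (1::int) i) p = p ^ i" for i
    by (induction i) (simp_all add: monom_Suc monom_0 pcompose_pCons one_pCons)
  then show ?thesis
    by (simp add: f_poly_eq_sum pcompose_sum)
qed

lemma geometric_sum_add:
  fixes x :: "'a::comm_semiring_1"
  shows "(\<Sum>i<r + s. x ^ i) = (\<Sum>i<r. x ^ i) + x ^ r * (\<Sum>i<s. x ^ i)"
  by (induction s) (simp_all add: algebra_simps power_add)

lemma geometric_sum_dvd_mult:
  fixes x :: "'a::comm_semiring_1"
  shows "(\<Sum>i<s. x ^ i) dvd (\<Sum>i<d * s. x ^ i)"
  by (induction d) (simp_all add: geometric_sum_add)

text \<open>For \<open>w > 0\<close> this is the sum of t^(b - i) t^(i w) over i \<le> b: of b equal
  parts, b - i are kept and i are each broken into w smaller ones.\<close>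

definition digit_factor :: "nat \<Rightarrow> nat \<Rightarrow> int poly" where
  "digit_factor w b = monom 1 b * pcompose (f_poly (b + 1)) (monom 1 (w - 1))"

lemma digit_factor_0 [simp]: "digit_factor w 0 = 1"
  by (simp add: digit_factor_def pcompose_f_poly)

text \<open>This recurrence in \<open>b\<close> has the same shape as that of
  \<open>mult_part_factor_nth\<close>, so both can be run in one induction.\<close>

lemma digit_factor_Suc:
  assumes "w > 0"
  shows "digit_factor w (Suc b) = monom 1 (Suc b * w) + monom 1 1 * digit_factor w b"
proof -
  have "Suc b + (w - 1) * Suc b = Suc b * w"
    using assms by (cases w) auto
  then have "monom 1 (Suc b) * monom 1 (w - 1) ^ Suc b = (monom 1 (Suc b * w) :: int poly)"
    by (simp only: monom_power mult_monom power_one mult_1_left)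
  moreover have "monom 1 (Suc b) = monom 1 1 * (monom 1 b :: int poly)"
    by (simp add: mult_monom)
  ultimately show ?thesis
    unfolding digit_factor_def pcompose_f_poly
    by (simp add: distrib_left mult.assoc del: power_Suc)
qed

text \<open>Cut the geometric sum after \<open>r + 1\<close> terms. The head gives the subtracted
  product; the tail is a power of t times a geometric sum of length \<open>d * v\<close>, which the
  one of length \<open>v\<close> divides.\<close>

lemma digit_factor_carry:
  assumes "w > 0" "v > 0"
  shows "monom 1 (w + v - 1) * pcompose (f_poly v) (monom 1 (w - 1)) dvd
         digit_factor w (r + d * v) - monom 1 (d * v) * digit_factor w r"
proof (cases d)
  case 0
  then show ?thesis by simp
next
  case (Suc e)
  define x :: "int poly" where "x = monom 1 (w - 1)"
  have "digit_factor w (r + d * v) =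
        monom 1 (r + d * v) * (\<Sum>i<(r + 1) + d * v. x ^ i)"
    by (simp add: digit_factor_def pcompose_f_poly x_def add_ac)
  also have "\<dots> = monom 1 (r + d * v) * (\<Sum>i<r + 1. x ^ i) +
      (monom 1 (r + d * v) * x ^ (r + 1)) * (\<Sum>i<d * v. x ^ i)"
    unfolding geometric_sum_add by (simp add: algebra_simps)
  also have "monom 1 (r + d * v) * (\<Sum>i<r + 1. x ^ i) =
      monom 1 (d * v) * digit_factor w r"
    by (simp add: digit_factor_def pcompose_f_poly x_def mult_monom add_ac
        flip: mult.assoc)
  finally have eq: "digit_factor w (r + d * v) - monom 1 (d * v) * digit_factor w r =
      (monom 1 (r + d * v) * x ^ (r + 1)) * (\<Sum>i<d * v. x ^ i)"
    by simp
  \<comment> \<open>Here d \<ge> 1, so the term \<open>d * v\<close> already supplies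
    \<open>v\<close>.\<close>
  have "w + v - 1 \<le> r + d * v + (w - 1) * (r + 1)"
    using assms Suc by (cases w) auto
  then have "monom 1 (w + v - 1) dvd monom (1::int) (r + d * v + (w - 1) * (r + 1))"
    by (metis le_add_diff_inverse mult_monom mult_1_left dvd_triv_left)
  also have "\<dots> = monom 1 (r + d * v) * x ^ (r + 1)"
    by (simp only: x_def monom_power mult_monom power_one mult_1_left)
  finally show ?thesis
    unfolding eq pcompose_f_poly x_def
    using geometric_sum_dvd_mult by (intro mult_dvd_mono)
qed

lemma mult_part_factor_nth:
  assumes "w > 0"
  shows "fps_nth (P * part_factor w) n =
    fps_nth P n + (if n < w then 0 else monom 1 1 * fps_nth (P * part_factor w) (n - w))"
proof -
  have "P * part_factor w =
      P * ((1 - fps_const (monom 1 1) * fps_X ^ w) * part_factor w) +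
      fps_const (monom 1 1) * (fps_X ^ w * (P * part_factor w))"
    by (simp add: algebra_simps)
  also have "\<dots> = P + fps_const (monom 1 1) * (fps_X ^ w * (P * part_factor w))"
    by (simp only: part_factor_inverse[OF assms] mult_1_right)
  finally have "fps_nth (P * part_factor w) n =
      fps_nth (P + fps_const (monom 1 1) * (fps_X ^ w * (P * part_factor w))) n"
    by simp
  then show ?thesis
    by (simp add: fps_X_power_mult_nth)
qed

text \<open>Modulo g, the multiplicity of the part \<open>W\<close> turns the powers t^(d w) into
  their sum \<open>digit_factor w b\<close>. Since \<open>N < W\<close>, the recurrence stops at b =
  0.\<close>

lemma mult_part_factor_nth_cong:
  assumes "w > 0" "N < W"
    and P: "\<And>d. g dvd fps_nth P (N + d * W) - A * monom 1 (d * w)"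
  shows "g dvd fps_nth (P * part_factor W) (N + b * W) - A * digit_factor w b"
proof (induction b)
  case 0
  show ?case
    using P[of 0] assms(2) by (simp add: mult_part_factor_nth)
next
  case (Suc b)
  have "fps_nth (P * part_factor W) (N + Suc b * W) - A * digit_factor w (Suc b) =
      (fps_nth P (N + Suc b * W) - A * monom 1 (Suc b * w)) +
      monom 1 1 * (fps_nth (P * part_factor W) (N + b * W) - A * digit_factor w b)"
    using assms(1,2)
    by (subst mult_part_factor_nth) (auto simp: digit_factor_Suc algebra_simps)
  then show ?case
    using P[of "Suc b"] Suc by (metis dvd_add dvd_mult)
qed

lemma Mprod_Suc: "Mprod m (Suc i) = m (Suc i) * Mprod m i"
  by (simp add: Mprod_def)

lemma digit_sum_less_Mprod:
  assumes "m 0 = 1" "\<And>j. j \<le> k \<Longrightarrow> a j < m (j + 1)"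
  shows "(\<Sum>j\<le>k. a j * Mprod m j) < Mprod m (Suc k)"
  using assms(2)
proof (induction k)
  case 0
  then show ?case using assms(1) by (simp add: Mprod_def)
next
  case (Suc k)
  have "(\<Sum>j\<le>Suc k. a j * Mprod m j) < Suc (a (Suc k)) * Mprod m (Suc k)"
    using Suc by simp
  also have "\<dots> \<le> m (Suc (Suc k)) * Mprod m (Suc k)"
    using Suc.prems[of "Suc k"] by (intro mult_right_mono) auto
  finally show ?case by (simp only: Mprod_Suc)
qed

lemma part_factor_1_nth: "fps_nth (part_factor 1) n = monom 1 n"
proof (induction n)
  case (Suc n)
  then show ?case
    using mult_part_factor_nth[of 1 1 "Suc n"] by (simp add: mult_monom)
qed simp

lemma partial_prod_nth_cong:
  assumes "m 0 = 1" "\<And>i. i \<ge> 1 \<Longrightarrow> m i \<ge> 2" "\<And>j. j \<le> k \<Longrightarrow> a j < m (j + 1)"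
  shows "g_poly m k dvd
    fps_nth (\<Prod>j\<le>Suc k. part_factor (Mprod m j))
      ((\<Sum>j\<le>k. a j * Mprod m j) + b * Mprod m (Suc k)) -
    monom 1 (a 0) * (\<Prod>j=1..k. digit_factor (m j) (a j)) * digit_factor (m (Suc k)) b"
  using assms(3)
proof (induction k arbitrary: b)
  \<comment> \<open>As \<open>g_poly m 0\<close> is 0, equality is needed: the part 1 alone gives
    the coefficient t^(a_0 + d m_1) = t^(a_0) t^(d m_1).\<close>
  case 0
  show ?case
    unfolding prod.atMost_Suc
    by (rule mult_part_factor_nth_cong)
      (use assms(1) assms(2)[of 1] 0 in
        \<open>auto simp: Mprod_def part_factor_1_nth[simplified] mult_monom\<close>)
next
  case (Suc k)
  let ?A = "monom 1 (a 0) * (\<Prod>j=1..k. digit_factor (m j) (a j))"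
  let ?P = "\<Prod>j\<le>Suc k. part_factor (Mprod m j)"
  let ?N = "\<lambda>k. \<Sum>j\<le>k. a j * Mprod m j"
  let ?g = "g_poly m (Suc k)"
  let ?r = "a (Suc k)" and ?w = "m (Suc k)" and ?v = "m (Suc (Suc k))"
  have "?g dvd fps_nth ?P (?N (Suc k) + d * Mprod m (Suc (Suc k))) -
      ?A * digit_factor ?w ?r * monom 1 (d * ?v)" for d
  proof -
    have "?N (Suc k) + d * Mprod m (Suc (Suc k)) =
        ?N k + (?r + d * ?v) * Mprod m (Suc k)"
      by (simp add: Mprod_Suc algebra_simps)
    moreover have "?g dvd g_poly m k"
      by (simp add: g_poly_Suc)
    moreover have "g_poly m k dvd fps_nth ?P (?N k + (?r + d * ?v) * Mprod m (Suc k)) -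
        ?A * digit_factor ?w (?r + d * ?v)"
      \<comment> \<open>The induction hypothesis applies to the top digit
        \<open>?r + d * ?v\<close>, which need not be below \<open>?v\<close>.\<close>
      using Suc by simp
    ultimately have 1: "?g dvd fps_nth ?P (?N (Suc k) + d * Mprod m (Suc (Suc k))) -
        ?A * digit_factor ?w (?r + d * ?v)"
      by (simp only:) (erule (1) dvd_trans)
    have "?g dvd monom 1 (?w + ?v - 1) * pcompose (f_poly ?v) (monom 1 (?w - 1))"
      by (simp add: g_poly_Suc)
    also have "\<dots> dvd digit_factor ?w (?r + d * ?v) - monom 1 (d * ?v) * digit_factor ?w ?r"
      using assms(2)[of "Suc k"] assms(2)[of "Suc (Suc k)"] by (intro digit_factor_carry) auto
    finally have 2: "?g dvd
        ?A * (digit_factor ?w (?r + d * ?v) - monom 1 (d * ?v) * digit_factor ?w ?r)"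
      by (rule dvd_mult)
    show ?thesis
      using dvd_add[OF 1 2] by (simp add: algebra_simps)
  qed
  moreover have "?N (Suc k) < Mprod m (Suc (Suc k))"
    using assms(1) Suc.prems by (rule digit_sum_less_Mprod)
  ultimately have "?g dvd fps_nth (?P * part_factor (Mprod m (Suc (Suc k))))
        (?N (Suc k) + b * Mprod m (Suc (Suc k))) -
      ?A * digit_factor ?w ?r * digit_factor ?v b"
    using assms(2)[of "Suc (Suc k)"]
    by (intro mult_part_factor_nth_cong) auto
  then show ?case
    by (simp add: mult.assoc)
qed

lemma partition_poly_eq_partial_prod:
  assumes "m 0 = 1" "\<And>i. i \<ge> 1 \<Longrightarrow> m i \<ge> 2" "n < Mprod m k"
  shows "partition_poly m n = fps_nth (\<Prod>j\<le>k. part_factor (Mprod m j)) n"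
proof -
  have "mono (Mprod m)"
  proof (rule incseq_SucI)
    show "Mprod m i \<le> Mprod m (Suc i)" for i
      using assms(2)[of "Suc i"] by (simp add: Mprod_Suc)
  qed
  have "fps_nth (\<Prod>j\<le>K. part_factor (Mprod m j)) n =
      fps_nth (\<Prod>j\<le>k. part_factor (Mprod m j)) n" if "k \<le> K" for K
    using that
  proof (induction K rule: dec_induct)
    case (step K)
    have "n < Mprod m (Suc K)"
      using assms(3) monoD[OF \<open>mono (Mprod m)\<close>, of k "Suc K"] step by simp
    then show ?case
      using step by (simp add: mult_part_factor_nth)
  qed simp
  \<comment> \<open>\<open>partition_poly_eq\<close> truncates the product at n, which may lie on
    either side of k; both truncations agree with the one at \<open>max n k\<close>.\<close>
  from this[of "max n k"] show ?thesis
    using partial_prod_nth_stable[of m n "max n k"] assms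
    by (simp add: partition_poly_eq)
qed

theorem theorem5p3:
  fixes m a :: "nat \<Rightarrow> nat" and n k :: nat
  assumes "m 0 = 1"
    and "\<And>i. i \<ge> 1 \<Longrightarrow> m i \<ge> 2"
    and "\<And>j. j \<le> k \<Longrightarrow> a j < m (j + 1)"
    and "n = (\<Sum>j\<le>k. a j * Mprod m j)"
  shows "g_poly m k dvd
           partition_poly m n -
           monom 1 (a 0) *
           (\<Prod>j=1..k. monom 1 (a j) * pcompose (f_poly (a j + 1)) (monom 1 (m j - 1)))"
proof -
  have "n < Mprod m (Suc k)"
    using digit_sum_less_Mprod[OF assms(1,3)] assms(4) by simp
  then have "partition_poly m n = fps_nth (\<Prod>j\<le>Suc k. part_factor (Mprod m j)) n"
    by (intro partition_poly_eq_partial_prod assms)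
  then show ?thesis
    \<comment> \<open>With b = 0 the extra top digit contributes the factor 1.\<close>
    using partial_prod_nth_cong[where m = m and k = k and a = a and b = 0, OF assms(1-3)]
    unfolding digit_factor_def[symmetric] by (simp add: assms(4))
qed

end
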